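(* Let $\psi$ be a measure of non-constantness on $\mathscr{C}_{\mathrm{cond}}=\mathcal{F}(\mathbb{R}^p,\mathscr{C})$, where $\mathscr{C}$ is the set of $d$-dimensional copulas. Define a symmetrized version of $\psi$ by $$\psi_{\mathrm{sym}}(C_{\mathbf{X}|\mathbf{Z}}):=\frac{1}{d!\,p!}\sum_{\pi_{\mathbf{X}}\in\mathfrak{S}_d}\ \sum_{\pi_{\mathbf{Z}}\in\mathfrak{S}_p}\psi\big(C_{\pi_{\mathbf{X}}(\mathbf{X})|\pi_{\mathbf{Z}}(\mathbf{Z})}\big)$$ for any $C_{\mathbf{X}|\mathbf{Z}}\in\mathscr{C}_{\mathrm{cond}}$. Then $\psi_{\mathrm{sym}}$ is a measure of non-simplifyingness.
   Context: Let $\mathscr{C}$ be the set of all $d$-dimensional copulas (a subset of the real vector space of functions $[0,1]^d\to\mathbb{R}$), and let $\mathscr{C}_{\mathrm{cond}}=\mathcal{F}(\mathbb{R}^p,\mathscr{C})$ be the set of conditional copulas, i.e. of all (measurable) functions from $\mathbb{R}^p$ to $\mathscr{C}$. An element of $\mathscr{C}_{\mathrm{cond}}$ is written $C_{\mathbf{X}|\mathbf{Z}}$, thought of as the conditional copula $\mathbf{z}\mapsto C_{\mathbf{X}|\mathbf{Z}}(\,\cdot\,|\mathbf{Z}=\mathbf{z})$ of a $d$-dimensional random vector $\mathbf{X}$ given a $p$-dimensional random vector $\mathbf{Z}$ (with continuous conditional margins). Measure of non-constantness: let $\mathcal{Z}$ be a set, $E$ a real vector space, and $\mathcal{G}$ a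 subset of the set $\mathcal{F}(\mathcal{Z},E)$ of functions from $\mathcal{Z}$ to $E$. A function $\psi:\mathcal{G}\to[0,+\infty]$ is a measure of non-constantness (on $\mathcal{G}$) if (i) for any $f\in\mathcal{G}$, $\psi(f)=0$ if and only if $f$ is constant; (ii) for any $f\in\mathcal{G}$ and any $e\in E$ such that $f+e\in\mathcal{G}$, $\psi(f+e)=\psi(f)$; (iii) for any $f,g\in\mathcal{G}$ such that $f+g\in\mathcal{G}$, $\psi(f+g)\le\psi(f)+\psi(g)$; (iv) for any $f\in\mathcal{G}$ and $a\in\mathbb{R}$ such that $af\in\mathcal{G}$, $\psi(af)=|a|\,\psi(f)$, with the convention $0\times\infty=0$. Here this is applied with $\mathcal{Z}=\mathbb{R}^p$, $E$ the space of real functions on $[0,1]^d$, and $\mathcal{G}=\mathscr{C}_{\mathrm{cond}}$. Permutations: $\mathfrak{S}_k$ is the set of permutations of $\{1,\dots,k\}$, and $\pi(\mathbf{x}):=(x_{\pi(i)})_{i=1,\dots,k}$ for $\pi\in\mathfrak{S}_k$ and a $k$-dimensional vector $\mathbf{x}$. $C_{\pi_{\mathbf{X}}(\mathbf{X})|\pi_{\mathbf{Z}}(\mathbf{Z})}$ is the conditional copula of the permuted vector $\pi_{\mathbf{X}}(\mathbf{X})$ given $\pi_{\mathbf{Z}}(\mathbf{Z})$; explicitly, $C_{\pi_{\mathbf{X}}(\mathbf{X})|\pi_{\mathbf{Z}}(\mathbf{Z})}(\pi_{\mathbf{X}}(\mathbf{u})\,|\,\pi_{\mathbf{Z}}(\mathbf{z}))=C_{\mathbf{X}|\mathbf{Z}}(\mathbf{u}\,|\,\mathbf{z})$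 for all $\mathbf{u}\in[0,1]^d$, $\mathbf{z}\in\mathbb{R}^p$. The simplifying assumption for $C\in\mathscr{C}_{\mathrm{cond}}$ is that $\mathbf{z}\mapsto C(\,\cdot\,|\mathbf{z})$ is constant. A measure of non-simplifyingness is a function $\psi:\mathscr{C}_{\mathrm{cond}}\to[0,+\infty]$ such that: (i) for every $C\in\mathscr{C}_{\mathrm{cond}}$, $\psi(C)=0$ if and only if $C$ satisfies the simplifying assumption; (ii) $\psi(C_{\pi_{\mathbf{X}}(\mathbf{X})|\pi_{\mathbf{Z}}(\mathbf{Z})})=\psi(C_{\mathbf{X}|\mathbf{Z}})$ for all $C_{\mathbf{X}|\mathbf{Z}}\in\mathscr{C}_{\mathrm{cond}}$, $\pi_{\mathbf{X}}\in\mathfrak{S}_d$, $\pi_{\mathbf{Z}}\in\mathfrak{S}_p$. *)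

theory Defs
  imports
    "HOL-Probability.Probability"
    "HOL-Library.Function_Algebras"
    "HOL-Combinatorics.Permutations"
begin

text \<open>The index types \<open>'d\<close> and \<open>'p\<close> play the role of \<open>{1..d}\<close> and \<open>{1..p}\<close>, so
  vectors are elements of \<open>real ^ 'd\<close> and \<open>real ^ 'p\<close>.\<close>

instantiation "fun" :: (type, real_vector) real_vector
begin

definition scaleR_fun :: "real \<Rightarrow> ('a \<Rightarrow> 'b) \<Rightarrow> 'a \<Rightarrow> 'b"
  where "scaleR_fun a f = (\<lambda>x. a *\<^sub>R f x)"

instance
  by standard (simp_all add: scaleR_fun_def fun_eq_iff scaleR_add_right scaleR_add_left)

end

text \<open>Real functions on \<open>[0,1]\<^sup>d\<close> are encoded as functions on the whole space that
  vanish outside the cube, so that they form a vector space under pointwise operations.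
  A copula is therefore 0 outside the cube, unlike the distribution function of which it is
  the restriction.\<close>

definition cube_functions :: "(real ^ 'd \<Rightarrow> real) set"
  where "cube_functions = {h. \<forall>u. u \<notin> cbox 0 1 \<longrightarrow> h u = 0}"

lemma subspace_cube_functions: "subspace cube_functions"
  by (auto simp: subspace_def cube_functions_def scaleR_fun_def)

text \<open>Restrictions to \<open>[0,1]\<^sup>d\<close> of distribution functions with uniform margins; the order
  on \<open>real ^ 'd\<close> in \<open>{..u}\<close> is componentwise.\<close>

definition copulas :: "(real ^ 'd \<Rightarrow> real) set"
  where "copulas = {C \<in> cube_functions. \<exists>M :: (real ^ 'd) measure.
     prob_space M \<and> sets M = sets borel \<and>
     (\<forall>i. distr M borel (\<lambda>x. x $ i) = uniform_measure lborel {0..1}) \<and>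
     (\<forall>u \<in> cbox 0 1. C u = measure M {..u})}"

text \<open>The argument order is \<open>C z u\<close> for \<open>C(u | Z = z)\<close>.  Measurability is with respect to the
  \<open>\<sigma>\<close>-algebra generated by the evaluations \<open>C \<mapsto> C u\<close>.\<close>

definition conditional_copulas :: "(real ^ 'p \<Rightarrow> real ^ 'd \<Rightarrow> real) set"
  where "conditional_copulas =
    {C. (\<forall>z. C z \<in> copulas) \<and> (\<forall>u. (\<lambda>z. C z u) \<in> borel_measurable borel)}"

lemma conditional_copulas_subset: "conditional_copulas \<subseteq> UNIV \<rightarrow> cube_functions"
  by (auto simp: conditional_copulas_def copulas_def)

definition measure_of_nonconstantness ::
    "'e::real_vector set \<Rightarrow> ('z \<Rightarrow> 'e) set \<Rightarrow> (('z \<Rightarrow> 'e) \<Rightarrow> ennreal) \<Rightarrow> bool"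
  where "measure_of_nonconstantness E G \<psi> \<longleftrightarrow>
    (\<forall>f\<in>G. \<psi> f = 0 \<longleftrightarrow> f constant_on UNIV) \<and>
    (\<forall>f\<in>G. \<forall>e\<in>E. (\<lambda>z. f z + e) \<in> G \<longrightarrow> \<psi> (\<lambda>z. f z + e) = \<psi> f) \<and>
    (\<forall>f\<in>G. \<forall>g\<in>G. (\<lambda>z. f z + g z) \<in> G \<longrightarrow> \<psi> (\<lambda>z. f z + g z) \<le> \<psi> f + \<psi> g) \<and>
    (\<forall>f\<in>G. \<forall>a::real. (\<lambda>z. a *\<^sub>R f z) \<in> G \<longrightarrow> \<psi> (\<lambda>z. a *\<^sub>R f z) = ennreal \<bar>a\<bar> * \<psi> f)"

definition permute_vec :: "('n \<Rightarrow> 'n) \<Rightarrow> 'a ^ 'n \<Rightarrow> 'a ^ 'n"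
  where "permute_vec \<pi> x = (\<chi> i. x $ \<pi> i)"

text \<open>The conditional copula of \<open>\<pi>\<^sub>X(X)\<close> given \<open>\<pi>\<^sub>Z(Z)\<close>.  The inverses come from solving
  the defining equation, which is the lemma \<open>permute_conditional_copula_eq\<close> below.\<close>

definition permute_conditional_copula ::
    "('d \<Rightarrow> 'd) \<Rightarrow> ('p \<Rightarrow> 'p) \<Rightarrow> (real ^ 'p \<Rightarrow> real ^ 'd \<Rightarrow> real) \<Rightarrow> real ^ 'p \<Rightarrow> real ^ 'd \<Rightarrow> real"
  where "permute_conditional_copula \<pi>X \<pi>Z C =
    (\<lambda>z u. C (permute_vec (inv \<pi>Z) z) (permute_vec (inv \<pi>X) u))"

lemma permute_conditional_copula_eq:
  assumes "\<pi>X permutes UNIV" "\<pi>Z permutes UNIV"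
  shows "permute_conditional_copula \<pi>X \<pi>Z C (permute_vec \<pi>Z z) (permute_vec \<pi>X u) = C z u"
  using assms
  by (simp add: permute_conditional_copula_def permute_vec_def permutes_inverses)

definition simplifying_assumption :: "(real ^ 'p \<Rightarrow> real ^ 'd \<Rightarrow> real) \<Rightarrow> bool"
  where "simplifying_assumption C \<longleftrightarrow> C constant_on UNIV"

definition measure_of_nonsimplifyingness ::
    "((real ^ 'p \<Rightarrow> real ^ 'd \<Rightarrow> real) \<Rightarrow> ennreal) \<Rightarrow> bool"
  where "measure_of_nonsimplifyingness \<psi> \<longleftrightarrow>
    (\<forall>C\<in>conditional_copulas. \<psi> C = 0 \<longleftrightarrow> simplifying_assumption C) \<and>
    (\<forall>C\<in>conditional_copulas. \<forall>\<pi>X \<pi>Z. \<pi>X permutes UNIV \<longrightarrow> \<pi>Z permutes UNIV \<longrightarrow>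
       \<psi> (permute_conditional_copula \<pi>X \<pi>Z C) = \<psi> C)"

definition symmetrized ::
    "((real ^ 'p \<Rightarrow> real ^ 'd \<Rightarrow> real) \<Rightarrow> ennreal) \<Rightarrow> (real ^ 'p \<Rightarrow> real ^ 'd \<Rightarrow> real) \<Rightarrow> ennreal"
  where "symmetrized \<psi> C =
    ennreal (1 / (fact CARD('d) * fact CARD('p))) *
    (\<Sum>\<pi>X | \<pi>X permutes UNIV. \<Sum>\<pi>Z | \<pi>Z permutes UNIV.
       \<psi> (permute_conditional_copula \<pi>X \<pi>Z C))"

end

theory Submission
  imports Defs
begin

text \<open>The copulas are stable under permutation of the coordinates, since permuting the arguments of
  a copula corresponds to the image of its measure under a permutation of the coordinates. The maps
  \<open>C \<mapsto> permute_conditional_copula \<pi>X \<pi>Z C\<close> form a (right) action of a finite group on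
  the conditional copulas, which preserves constancy. Averaging over the orbit yields an invariant
  function, and a sum of nonnegative terms vanishes iff each of them does.\<close>

lemma permute_vec_nth [simp]: "permute_vec \<pi> x $ i = x $ \<pi> i"
  by (simp add: permute_vec_def)

lemma permute_vec_permute_vec: "permute_vec \<sigma> (permute_vec \<pi> x) = permute_vec (\<pi> \<circ> \<sigma>) x"
  by (simp add: vec_eq_iff)

lemma borel_measurable_permute_vec [measurable]:
  "permute_vec \<pi> \<in> borel_measurable (borel :: (real ^ 'n) measure)"
proof -
  have "continuous_on UNIV (permute_vec \<pi> :: real ^ 'n \<Rightarrow> real ^ 'n)"
    unfolding permute_vec_def by (intro continuous_intros)
  then show ?thesis
    by (rule borel_measurable_continuous_onI)
qed

text \<open>Substituting \<open>\<pi> j\<close> for \<open>i\<close> in the componentwise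
  inequalities is harmless because \<open>\<pi>\<close> is onto. This identifies the preimage of a
  lower orthant under a permutation of coordinates as a lower orthant again.\<close>

lemma permute_vec_le_iff:
  fixes x y :: "'a::order ^ 'n"
  assumes "bij \<pi>"
  shows "permute_vec (inv \<pi>) x \<le> y \<longleftrightarrow> x \<le> permute_vec \<pi> y"
proof -
  have "(\<forall>i. x $ inv \<pi> i \<le> y $ i) \<longleftrightarrow> (\<forall>j. x $ inv \<pi> (\<pi> j) \<le> y $ \<pi> j)"
    using bij_is_surj[OF assms] by (metis surjD)
  then show ?thesis
    using bij_is_inj[OF assms] by (simp add: less_eq_vec_def)
qed

lemma permute_vec_mem_unit_cube_iff:
  fixes u :: "real ^ 'd"
  assumes "bij \<pi>"
  shows "permute_vec \<pi> u \<in> cbox 0 1 \<longleftrightarrow> u \<in> cbox 0 1"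
proof -
  have "(\<forall>i. 0 \<le> u $ \<pi> i \<and> u $ \<pi> i \<le> 1) \<longleftrightarrow> (\<forall>j. 0 \<le> u $ j \<and> u $ j \<le> 1)"
    using bij_is_surj[OF assms] by (metis surjD)
  then show ?thesis
    by (simp add: mem_box_cart)
qed

lemma copula_permute_vec:
  fixes C :: "real ^ 'd \<Rightarrow> real"
  assumes C: "C \<in> copulas" and \<pi>: "bij \<pi>"
  shows "(\<lambda>u. C (permute_vec \<pi> u)) \<in> copulas"
proof -
  obtain M :: "(real ^ 'd) measure" where M: "prob_space M" and sets_M: "sets M = sets borel"
    and margins: "\<And>i. distr M borel (\<lambda>x. x $ i) = uniform_measure lborel {0..1}"
    and cdf: "\<And>u. u \<in> cbox 0 1 \<Longrightarrow> C u = measure M {..u}"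
    using C unfolding copulas_def by blast
  have space_M: "space M = UNIV"
    using sets_eq_imp_space_eq[OF sets_M] by simp
  have permute_meas: "permute_vec (inv \<pi>) \<in> M \<rightarrow>\<^sub>M borel"
    using borel_measurable_permute_vec by (simp add: measurable_cong_sets[OF sets_M refl])
  \<comment> \<open>If \<open>X\<close> has law \<open>M\<close>, then \<open>N\<close> is the law
    of the vector with components \<open>X $ inv \<pi> i\<close>. The inverse is forced:
    \<open>X $ inv \<pi> i \<le> u $ i\<close> for all \<open>i\<close> means
    \<open>X $ j \<le> u $ \<pi> j\<close> for all \<open>j\<close>, an event of probability
    \<open>C (permute_vec \<pi> u)\<close>.\<close>
  define N where "N = distr M borel (permute_vec (inv \<pi>))"
  have "prob_space N"
    unfolding N_def using M permute_meas by (rule prob_space.prob_space_distr)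
  moreover have "sets N = sets borel"
    by (simp add: N_def)
  \<comment> \<open>The margin of \<open>N\<close> at \<open>i\<close> is the margin of
    \<open>M\<close> at \<open>inv \<pi> i\<close>, hence again uniform.\<close>
  moreover have "distr N borel (\<lambda>x. x $ i) = uniform_measure lborel {0..1}" for i
    unfolding N_def using margins[of "inv \<pi> i"] permute_meas
    by (subst distr_distr) (auto simp: comp_def)
  moreover have "C (permute_vec \<pi> u) = measure N {..u}" if "u \<in> cbox 0 1" for u
  proof -
    have "measure N {..u} = measure M (permute_vec (inv \<pi>) -` {..u} \<inter> space M)"
      unfolding N_def using permute_meas by (rule measure_distr) simp
    also have "permute_vec (inv \<pi>) -` {..u} \<inter> space M = {..permute_vec \<pi> u}"
      using permute_vec_le_iff[OF \<pi>] by (auto simp: space_M)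
    finally show ?thesis
      using that \<pi> by (simp add: cdf permute_vec_mem_unit_cube_iff)
  qed
  \<comment> \<open>The value 0 outside the cube is kept because a permutation of coordinates maps
    the complement of the cube into itself.\<close>
  moreover have "(\<lambda>u. C (permute_vec \<pi> u)) \<in> cube_functions"
    using C \<pi> by (simp add: copulas_def cube_functions_def permute_vec_mem_unit_cube_iff)
  ultimately show ?thesis
    unfolding copulas_def by blast
qed

lemma permute_conditional_copula_in_conditional_copulas:
  assumes C: "C \<in> conditional_copulas" and \<pi>X: "\<pi>X permutes UNIV"
  shows "permute_conditional_copula \<pi>X \<pi>Z C \<in> conditional_copulas"
proof -
  have "(\<lambda>z. C (permute_vec (inv \<pi>Z) z) u) \<in> borel_measurable borel" for u
  proof (rule measurable_compose[OF borel_measurable_permute_vec])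
    show "(\<lambda>z. C z u) \<in> borel_measurable borel"
      using C by (simp add: conditional_copulas_def)
  qed
  moreover have "bij (inv \<pi>X)"
    using \<pi>X by (simp add: permutes_bij bij_imp_bij_inv)
  ultimately show ?thesis
    using C by (simp add: conditional_copulas_def permute_conditional_copula_def copula_permute_vec)
qed

text \<open>Two reversals of order meet here: \<open>permute_vec\<close> reverses composition, which
  produces \<open>inv \<sigma> \<circ> inv \<pi>\<close>, and this is
  \<open>inv (\<pi> \<circ> \<sigma>)\<close>.\<close>

lemma permute_conditional_copula_compose:
  assumes "\<pi>X permutes UNIV" "\<pi>Z permutes UNIV" "\<sigma>X permutes UNIV" "\<sigma>Z permutes UNIV"
  shows "permute_conditional_copula \<sigma>X \<sigma>Z (permute_conditional_copula \<pi>X \<pi>Z C) =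
    permute_conditional_copula (\<pi>X \<circ> \<sigma>X) (\<pi>Z \<circ> \<sigma>Z) C"
  using assms
  by (simp add: permute_conditional_copula_def permute_vec_permute_vec o_inv_distrib permutes_bij)

lemma permute_conditional_copula_id: "permute_conditional_copula id id C = C"
  by (simp add: permute_conditional_copula_def permute_vec_def)

lemma permute_conditional_copula_inverse:
  assumes "\<pi>X permutes UNIV" "\<pi>Z permutes UNIV"
  shows "permute_conditional_copula (inv \<pi>X) (inv \<pi>Z) (permute_conditional_copula \<pi>X \<pi>Z C) = C"
  using assms
  by (simp add: permute_conditional_copula_compose permutes_inv permutes_inv_o
      permute_conditional_copula_id)

lemma constant_on_permute_conditional_copula:
  assumes "C constant_on UNIV"
  shows "permute_conditional_copula \<pi>X \<pi>Z C constant_on UNIV"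
  using assms unfolding constant_on_def permute_conditional_copula_def by auto

text \<open>The converse direction is the forward one applied to the permuted copula and the inverse
  permutations, which give back \<open>C\<close>.\<close>

lemma constant_on_permute_conditional_copula_iff:
  assumes "\<pi>X permutes UNIV" "\<pi>Z permutes UNIV"
  shows "permute_conditional_copula \<pi>X \<pi>Z C constant_on UNIV \<longleftrightarrow> C constant_on UNIV"
  by (metis assms constant_on_permute_conditional_copula permute_conditional_copula_inverse)

text \<open>Left composition with a fixed permutation is a bijection of the symmetric group, so the
  double sum is merely reordered.\<close>

lemma symmetrized_permute_conditional_copula:
  fixes \<psi> :: "(real ^ 'p \<Rightarrow> real ^ 'd \<Rightarrow> real) \<Rightarrow> ennreal"
  assumes \<pi>X: "\<pi>X permutes UNIV" and \<pi>Z: "\<pi>Z permutes UNIV"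
  shows "symmetrized \<psi> (permute_conditional_copula \<pi>X \<pi>Z C) = symmetrized \<psi> C"
proof -
  define F where "F \<sigma>X \<sigma>Z = \<psi> (permute_conditional_copula \<sigma>X \<sigma>Z C)" for \<sigma>X \<sigma>Z
  have "(\<Sum>\<sigma>X | \<sigma>X permutes UNIV. \<Sum>\<sigma>Z | \<sigma>Z permutes UNIV.
       \<psi> (permute_conditional_copula \<sigma>X \<sigma>Z (permute_conditional_copula \<pi>X \<pi>Z C))) =
     (\<Sum>\<sigma>X | \<sigma>X permutes UNIV. \<Sum>\<sigma>Z | \<sigma>Z permutes UNIV. F (\<pi>X \<circ> \<sigma>X) (\<pi>Z \<circ> \<sigma>Z))"
    by (intro sum.cong refl) (simp add: F_def permute_conditional_copula_compose \<pi>X \<pi>Z)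
  \<comment> \<open>The inner sum is reindexed first, for each fixed \<open>\<sigma>X\<close>. The
    outer sum follows, with the whole inner sum as its summand.\<close>
  also have "\<dots> = (\<Sum>\<sigma>X | \<sigma>X permutes UNIV. \<Sum>\<sigma>Z | \<sigma>Z permutes UNIV. F (\<pi>X \<circ> \<sigma>X) \<sigma>Z)"
    by (intro sum.cong refl setum_permutations_compose_left[OF \<pi>Z, symmetric])
  also have "\<dots> = (\<Sum>\<sigma>X | \<sigma>X permutes UNIV. \<Sum>\<sigma>Z | \<sigma>Z permutes UNIV. F \<sigma>X \<sigma>Z)"
    by (rule setum_permutations_compose_left[OF \<pi>X, symmetric])
  finally show ?thesis
    by (simp add: symmetrized_def F_def)
qed

lemma symmetrized_eq_0_iff:
  fixes C :: "real ^ 'p \<Rightarrow> real ^ 'd \<Rightarrow> real"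
  shows "symmetrized \<psi> C = 0 \<longleftrightarrow>
    (\<forall>\<pi>X \<pi>Z. \<pi>X permutes UNIV \<longrightarrow> \<pi>Z permutes UNIV \<longrightarrow> \<psi> (permute_conditional_copula \<pi>X \<pi>Z C) = 0)"
proof -
  \<comment> \<open>Positivity matters because \<open>ennreal\<close> sends every nonpositive real
    to 0; a zero factor would make the average vanish for every \<open>C\<close>.\<close>
  have "0 < fact CARD('d) * (fact CARD('p) :: real)"
    by simp
  then have "ennreal (1 / (fact CARD('d) * fact CARD('p))) \<noteq> 0"
    by (simp add: ennreal_eq_0_iff flip: not_less)
  then show ?thesis
    by (auto simp: symmetrized_def finite_permutations)
qed

theorem proposition15:
  fixes \<psi> :: "(real ^ 'p \<Rightarrow> real ^ 'd \<Rightarrow> real) \<Rightarrow> ennreal"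
  assumes "measure_of_nonconstantness cube_functions conditional_copulas \<psi>"
  shows "measure_of_nonsimplifyingness (symmetrized \<psi>)"
proof -
  have zero_iff: "\<psi> C = 0 \<longleftrightarrow> C constant_on UNIV" if "C \<in> conditional_copulas" for C
    using assms that unfolding measure_of_nonconstantness_def by blast
  have "symmetrized \<psi> C = 0 \<longleftrightarrow> simplifying_assumption C" if C: "C \<in> conditional_copulas" for C
  proof -
    have "\<psi> (permute_conditional_copula \<pi>X \<pi>Z C) = 0 \<longleftrightarrow> C constant_on UNIV"
      if "\<pi>X permutes UNIV" "\<pi>Z permutes UNIV" for \<pi>X \<pi>Z
      using C that by (simp add: zero_iff permute_conditional_copula_in_conditional_copulas
          constant_on_permute_conditional_copula_iff)
    \<comment> \<open>Without a permutation of each kind, the condition that all terms vanish would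
      hold vacuously and say nothing about \<open>C\<close>.\<close>
    moreover have "\<exists>\<pi>X::'d \<Rightarrow> 'd. \<pi>X permutes UNIV" "\<exists>\<pi>Z::'p \<Rightarrow> 'p. \<pi>Z permutes UNIV"
      by (rule exI, rule permutes_id)+
    ultimately show ?thesis
      by (auto simp: symmetrized_eq_0_iff simplifying_assumption_def)
  qed
  then show ?thesis
    unfolding measure_of_nonsimplifyingness_def
    by (simp add: symmetrized_permute_conditional_copula)
qed

end
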